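(* Let $\alpha\le 1$ be a real number, and let $\{X_n\}_{n\ge0}$ be the linearly edge-reinforced random walk on $\mathbb{Z}_+$ started at $0$ with initial weights $f(0,0)=1$, $f(0,x)=x^{\alpha}$ for $x\in\{1,2,\dots\}$, and reinforcement parameter $\Delta=0$ (i.e. unreinforced). (i) If $\alpha<-1$, then for any $\varepsilon>0$, $$\limsup_{n\to\infty}\frac{X_n}{n^{1/(1-\alpha)}}>0\quad\text{and}\quad\lim_{n\to\infty}\frac{X_n}{\{n(\log n)^{1+\varepsilon}\}^{1/(1-\alpha)}}=0\quad\text{almost surely.}$$ (ii) If $\alpha=-1$, then for any $\varepsilon>0$, $$\limsup_{n\to\infty}\frac{X_n}{n^{(1-\varepsilon)/2}}=+\infty\quad\text{and}\quad\lim_{n\to\infty}\frac{X_n}{\{n(\log n)^{1+\varepsilon}\}^{1/2}}=0\quad\text{almost surely.}$$ (iii) If $-1<\alpha\le1$, then for any $\varepsilon>0$, $$\limsup_{n\to\infty}\frac{X_n}{n^{1/2}}>0\quad\text{and}\quad\lim_{n\to\infty}\frac{X_n}{\{n(\log n)^{1+\varepsilon}\}^{1/2}}=0\quad\text{almost surely.}$$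
   Context: $\mathbb{Z}_+=\{0,1,2,\dots\}$. The linearly edge-reinforced random walk (LERRW) on $\mathbb{Z}_+$ with initial weights $f(0,x)>0$ ($x\in\mathbb{Z}_+$) and reinforcement parameter $\Delta\ge 0$ is the nearest-neighbour process $\{X_n\}_{n\ge0}$ on $\mathbb{Z}_+$ with $P(X_0=0)=1$ defined as follows. For $x\in\mathbb{Z}_+$ let $\phi_n(x)=\sum_{i=1}^n 1_{\{\{X_{i-1},X_i\}=\{x,x+1\}\}}$ be the number of traversals of the edge $\{x,x+1\}$ by time $n$, and let the weight of the edge $\{x,x+1\}$ at time $n$ be $w_n(x)=f(0,x)+\Delta\,\phi_n(x)$; set $w_n(-1)=0$ for all $n$. The transition probabilities are $$P(X_{n+1}=X_n+1\mid X_0,\dots,X_n)=1-P(X_{n+1}=X_n-1\mid X_0,\dots,X_n)=\frac{w_n(X_n)}{w_n(X_n-1)+w_n(X_n)}.$$ In particular, when $\Delta=0$ the weights are constant in time, and $\{X_n\}$ is a Markov chain. *)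

theory Defs
  imports "HOL-Probability.Probability"
begin

text \<open>
  A trajectory is a function \<open>p :: nat \<Rightarrow> nat\<close>, of which only the values \<open>p 0, \<dots>, p n\<close>
  matter at time \<open>n\<close>.  The edge \<open>{x, x + 1}\<close> is indexed by its left endpoint \<open>x\<close>.
\<close>

definition traversals :: "(nat \<Rightarrow> nat) \<Rightarrow> nat \<Rightarrow> nat \<Rightarrow> nat" where
  "traversals p n x = card {i \<in> {1..n}. {p (i - 1), p i} = {x, x + 1}}"

definition edge_weight :: "(nat \<Rightarrow> real) \<Rightarrow> real \<Rightarrow> (nat \<Rightarrow> nat) \<Rightarrow> nat \<Rightarrow> int \<Rightarrow> real" where
  "edge_weight f \<Delta> p n x =
     (if x < 0 then 0 else f (nat x) + \<Delta> * real (traversals p n (nat x)))"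

definition up_prob :: "(nat \<Rightarrow> real) \<Rightarrow> real \<Rightarrow> (nat \<Rightarrow> nat) \<Rightarrow> nat \<Rightarrow> real" where
  "up_prob f \<Delta> p n =
     edge_weight f \<Delta> p n (int (p n)) /
       (edge_weight f \<Delta> p n (int (p n) - 1) + edge_weight f \<Delta> p n (int (p n)))"

text \<open>
  The conditional probabilities given \<open>X\<^sub>0, \<dots>, X\<^sub>n\<close> are elementary ones: the history takes
  countably many values, and those of probability zero impose no condition.  A step down from
  \<open>p n\<close> is written additively because subtraction on \<^typ>\<open>nat\<close> truncates.
\<close>

locale lerrw = prob_space M for M :: "'a measure" +
  fixes X :: "nat \<Rightarrow> 'a \<Rightarrow> nat" and f :: "nat \<Rightarrow> real" and \<Delta> :: real
  assumes weight_pos: "\<And>x. f x > 0"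
    and reinforcement_nonneg: "\<Delta> \<ge> 0"
    and X_measurable: "\<And>n. X n \<in> measurable M (count_space UNIV)"
    and start: "\<P>(\<omega> in M. X 0 \<omega> = 0) = 1"
    and step_up: "\<And>n p. \<P>(\<omega> in M. \<forall>i\<le>n. X i \<omega> = p i) > 0 \<Longrightarrow>
      \<P>(\<omega> in M. X (n + 1) \<omega> = p n + 1 \<bar> \<forall>i\<le>n. X i \<omega> = p i) = up_prob f \<Delta> p n"
    and step_down: "\<And>n p. \<P>(\<omega> in M. \<forall>i\<le>n. X i \<omega> = p i) > 0 \<Longrightarrow>
      \<P>(\<omega> in M. X (n + 1) \<omega> + 1 = p n \<bar> \<forall>i\<le>n. X i \<omega> = p i) = 1 - up_prob f \<Delta> p n"

end

theory Submission
  imports Defs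
begin

text \<open>
  Without reinforcement the walk is a birth--death chain with conductances \<open>c\<close>.  Its behaviour is
  read off from one function of the position, the expected time \<open>hit_time c x\<close> needed to reach \<open>x\<close>
  from \<open>0\<close>.  Writing \<open>g\<close> for it, \<open>g (X\<^sub>n) - n\<close> is a martingale (\<open>hit_time_drift\<close> for one step,
  \<open>drift\<close> on events determined by the past), and both halves of the theorem compare \<open>g (X\<^sub>n)\<close> with \<open>n\<close>.

  \<^item> From above, the maximal inequality \<open>P (max\<^sub>k\<^sub>\<le>\<^sub>n g (X\<^sub>k) \<ge> \<mu>) \<le> n / \<mu>\<close> and the Borel--Cantelli
    lemma along \<open>n = 2\<^sup>j\<close> give \<open>g (X\<^sub>n) / (n (ln n)\<^bsup>1+\<epsilon>\<^esup>) \<longlongrightarrow> 0\<close> (\<open>AE_hit_time_upper\<close>).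
  \<^item> From below, \<open>g (X\<^sub>n) > \<delta> n\<close> infinitely often for some \<open>\<delta> > 0\<close> (\<open>AE_hit_time_lower\<close>).  If instead
    \<open>g (X\<^sub>k) \<le> \<delta> k\<close> for all \<open>k\<close> between \<open>m\<close> and \<open>N\<close>, then the martingale is at most
    \<open>- (1 - \<delta>) N\<close> at time \<open>N\<close>; at the first violation it is still nonpositive, provided that \<open>g\<close> cannot
    grow by more than a constant factor in a step and \<open>m\<close> is large.  Since its mean at time \<open>m\<close> is at least \<open>- m\<close>, the
    probability of no violation before \<open>N\<close> is \<open>O(m / N)\<close>.

  It remains to estimate \<open>g\<close> for \<open>c x = x\<^sup>\<alpha>\<close>.  The increment of \<open>g\<close> at \<open>x\<close> is \<open>mass c x / c x\<close>, where
  \<open>mass c x\<close> is the mass of \<open>{0..x}\<close> under the reversible measure.  This mass is bounded for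
  \<open>\<alpha> < -1\<close>, logarithmic for \<open>\<alpha> = -1\<close>, and of order \<open>x\<^bsup>1+\<alpha>\<^esup>\<close> for \<open>\<alpha> > -1\<close>.  So \<open>g\<close> is of order
  \<open>x\<^bsup>1-\<alpha>\<^esup>\<close>, \<open>x\<^sup>2 ln x\<close> and \<open>x\<^sup>2\<close> respectively, which are the three regimes.  At \<open>\<alpha> = -1\<close> the logarithm
  is absorbed in a power \<open>x\<^sup>\<epsilon>\<close>, whence the loss in the exponent there.
\<close>

section \<open>Expected hitting times of a birth--death chain\<close>

text \<open>
  The reversible measure gives \<open>y\<close> the mass \<open>c (y - 1) + c y\<close>; this is its sum over \<open>{0..x}\<close>.
\<close>
definition mass :: "(nat \<Rightarrow> real) \<Rightarrow> nat \<Rightarrow> real" where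
  "mass c x = 2 * (\<Sum>y<x. c y) + c x"

text \<open>
  The expected time to reach \<open>x\<close> from \<open>0\<close>: the passage from \<open>y\<close> to \<open>y + 1\<close> takes the mean time
  \<open>mass c y / c y\<close>.  This meaning enters through \<open>hit_time_drift\<close>.
\<close>
definition hit_time :: "(nat \<Rightarrow> real) \<Rightarrow> nat \<Rightarrow> real" where
  "hit_time c x = (\<Sum>y<x. mass c y / c y)"

lemma hit_time_0 [simp]: "hit_time c 0 = 0"
  by (simp add: hit_time_def)

lemma hit_time_Suc: "hit_time c (Suc x) = hit_time c x + mass c x / c x"
  by (simp add: hit_time_def)

lemma mass_Suc: "mass c (Suc x) = mass c x + c x + c (Suc x)"
  by (simp add: mass_def)

lemma mass_ge_weight:
  assumes "\<And>x. c x > 0"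
  shows "c x \<le> mass c x"
  using sum_nonneg[of "{..<x}" c] assms by (simp add: mass_def less_imp_le)

lemma mass_pos:
  assumes "\<And>x. c x > 0"
  shows "mass c x > 0"
  using mass_ge_weight[of c x, OF assms] assms[of x] by linarith

lemma mono_hit_time:
  assumes "\<And>x. c x > 0"
  shows "mono (hit_time c)"
  by (rule mono_iff_le_Suc[THEN iffD2])
    (use mass_pos[of c] assms in \<open>simp add: hit_time_Suc less_imp_le\<close>)

lemma hit_time_nonneg:
  assumes "\<And>x. c x > 0"
  shows "0 \<le> hit_time c x"
  using monoD[OF mono_hit_time[of c, OF assms], of 0 x] by simp

text \<open>
  One step raises \<open>hit_time c\<close> by \<open>1\<close> on average: writing \<open>D y = mass c y / c y\<close>, this is
  \<open>c x * D x - c (x - 1) * D (x - 1) = c (x - 1) + c x\<close>, the recursion satisfied by \<open>mass\<close>.  At \<open>x = 0\<close>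
  the up-probability is \<open>1\<close>, so the truncated \<open>x - 1\<close> has coefficient \<open>0\<close>.
\<close>
lemma hit_time_drift:
  assumes pos: "\<And>x. c x > 0"
    and u: "u = c x / ((if x = 0 then 0 else c (x - 1)) + c x)"
  shows "u * hit_time c (x + 1) + (1 - u) * hit_time c (x - 1) = hit_time c x + 1"
proof (cases x)
  case 0
  then have "u = 1" using u pos[of 0] by simp
  then show ?thesis using 0 pos[of 0] by (simp add: hit_time_def mass_def)
next
  case (Suc y)
  let ?a = "c y" and ?b = "c (Suc y)" and ?m = "mass c y"
  have ab: "?a > 0" "?b > 0" "?a + ?b > 0" using pos by (auto simp: add_pos_pos)
  have u': "u = ?b / (?a + ?b)" using u Suc by simp
  have "u * (mass c (Suc y) / ?b) - (1 - u) * (?m / ?a) = 1"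
  proof -
    have "1 - u = ?a / (?a + ?b)" using u' ab by (simp add: field_simps)
    then have "u * (mass c (Suc y) / ?b) - (1 - u) * (?m / ?a)
        = mass c (Suc y) / (?a + ?b) - ?m / (?a + ?b)"
      using u' ab by simp
    also have "\<dots> = 1" using ab by (simp add: mass_Suc flip: diff_divide_distrib)
    finally show ?thesis .
  qed
  then show ?thesis
    using Suc by (simp add: hit_time_Suc algebra_simps add_divide_distrib diff_divide_distrib)
qed

text \<open>
  Bounded ratios of neighbouring weights bound the overshoot of \<open>hit_time c (X n)\<close> when it first
  exceeds a level.
\<close>
lemma hit_time_growth:
  assumes pos: "\<And>x. c x > 0" and R: "R \<ge> 1"
    and ratio: "\<And>x. c (Suc x) \<le> R * c x" "\<And>x. c x \<le> R * c (Suc x)"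
  shows "hit_time c (Suc x) \<le> (2 + R) * R * (hit_time c x + 1)"
proof (induction x)
  case 0
  have "1 * 1 \<le> (2 + R) * R" using R by (intro mult_mono) auto
  then show ?case using pos[of 0] by (simp add: hit_time_Suc mass_def)
next
  case (Suc x)
  have "R * c x \<le> R * mass c x"
    using mass_ge_weight[of c x, OF pos] R by (intro mult_left_mono) auto
  moreover have "0 \<le> mass c x" using mass_pos[of c x, OF pos] by simp
  ultimately have "mass c (Suc x) \<le> (2 + R) * mass c x"
    using mass_ge_weight[of c x, OF pos] ratio(1)[of x] unfolding mass_Suc distrib_right by linarith
  then have "mass c (Suc x) / c (Suc x) \<le> (2 + R) * mass c x / c (Suc x)"
    using pos by (simp add: divide_right_mono less_imp_le)
  also have "\<dots> \<le> (2 + R) * mass c x / (c x / R)"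
    using ratio(2)[of x] pos R mass_pos[of c x, OF pos]
    by (intro divide_left_mono) (auto simp: field_simps)
  also have "\<dots> = (2 + R) * R * (mass c x / c x)" using R by simp
  finally show ?case using Suc
    by (simp only: hit_time_Suc distrib_left)
qed

section \<open>The one-step martingale identity\<close>

locale unreinforced = lerrw M X c 0 for M :: "'a measure" and X c
begin

declare X_measurable [measurable]

abbreviation g where "g \<equiv> hit_time c"

lemma g_mono: "x \<le> y \<Longrightarrow> g x \<le> g y"
  using mono_hit_time[OF weight_pos] by (rule monoD)

lemma g_nonneg: "0 \<le> g x"
  by (rule hit_time_nonneg[OF weight_pos])

lemma up_prob_unreinforced:
  "up_prob c 0 p n = c (p n) / ((if p n = 0 then 0 else c (p n - 1)) + c (p n))"
  by (simp add: up_prob_def edge_weight_def nat_diff_distrib')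

definition cylinder :: "nat \<Rightarrow> (nat \<Rightarrow> nat set) \<Rightarrow> 'a set" where
  "cylinder n A = {\<omega> \<in> space M. \<forall>i\<le>n. X i \<omega> \<in> A i}"

lemma cylinder_sets [measurable]: "cylinder n A \<in> sets M"
  unfolding cylinder_def by measurable

text \<open>
  Clearing denominators in the conditional probabilities makes them valid for null histories too.
\<close>
lemma step_joint:
  fixes n p
  defines "u \<equiv> up_prob c 0 p n"
  shows "\<P>(\<omega> in M. X (n + 1) \<omega> = p n + 1 \<and> (\<forall>i\<le>n. X i \<omega> = p i)) = u * \<P>(\<omega> in M. \<forall>i\<le>n. X i \<omega> = p i)"
    and "\<P>(\<omega> in M. X (n + 1) \<omega> + 1 = p n \<and> (\<forall>i\<le>n. X i \<omega> = p i)) = (1 - u) * \<P>(\<omega> in M. \<forall>i\<le>n. X i \<omega> = p i)"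
proof -
  let ?H = "{\<omega> \<in> space M. \<forall>i\<le>n. X i \<omega> = p i}"
  have joint: "\<P>(\<omega> in M. Q \<omega> \<and> (\<forall>i\<le>n. X i \<omega> = p i)) = v * measure M ?H"
    if "measure M ?H > 0 \<Longrightarrow> \<P>(\<omega> in M. Q \<omega> \<bar> \<forall>i\<le>n. X i \<omega> = p i) = v" for Q v
  proof (cases "measure M ?H = 0")
    case True
    have "\<P>(\<omega> in M. Q \<omega> \<and> (\<forall>i\<le>n. X i \<omega> = p i)) \<le> measure M ?H"
      by (rule finite_measure_mono) auto
    with True show ?thesis by (simp add: measure_le_0_iff)
  next
    case False
    then have "measure M ?H > 0" by (simp add: zero_less_measure_iff)
    from that[OF this] False show ?thesis by (simp add: cond_prob_def field_simps)
  qed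
  show "\<P>(\<omega> in M. X (n + 1) \<omega> = p n + 1 \<and> (\<forall>i\<le>n. X i \<omega> = p i)) = u * measure M ?H"
    unfolding u_def by (rule joint) (rule step_up)
  show "\<P>(\<omega> in M. X (n + 1) \<omega> + 1 = p n \<and> (\<forall>i\<le>n. X i \<omega> = p i)) = (1 - u) * measure M ?H"
    unfolding u_def by (rule joint) (rule step_down)
qed

text \<open>
  For each history the two joint probabilities add up to that of the history, so no other step has
  positive probability; there are countably many histories, coded by lists.
\<close>
lemma AE_step: "AE \<omega> in M. X (n + 1) \<omega> = X n \<omega> + 1 \<or> X (n + 1) \<omega> + 1 = X n \<omega>"
proof -
  have atom: "AE \<omega> in M. (\<forall>i\<le>n. X i \<omega> = p i) \<longrightarrow> X (n + 1) \<omega> = p n + 1 \<or> X (n + 1) \<omega> + 1 = p n" for p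
  proof -
    let ?H = "{\<omega> \<in> space M. \<forall>i\<le>n. X i \<omega> = p i}"
    let ?U = "{\<omega> \<in> space M. X (n + 1) \<omega> = p n + 1 \<and> (\<forall>i\<le>n. X i \<omega> = p i)}"
    let ?D = "{\<omega> \<in> space M. X (n + 1) \<omega> + 1 = p n \<and> (\<forall>i\<le>n. X i \<omega> = p i)}"
    have "measure M (?U \<union> ?D) = measure M ?U + measure M ?D"
      by (rule finite_measure_Union) (measurable, auto)
    also have "\<dots> = measure M ?H"
      unfolding step_joint by (simp add: algebra_simps)
    finally have "measure M (?H - (?U \<union> ?D)) = 0"
      by (subst finite_measure_Diff) (measurable, auto)
    then have "AE \<omega> in M. \<omega> \<notin> ?H - (?U \<union> ?D)"
      by (intro AE_not_in) (auto simp: null_sets_def emeasure_eq_measure)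
    then show ?thesis by (rule AE_mp) auto
  qed
  have "AE \<omega> in M. \<forall>l::nat list. (\<forall>i\<le>n. X i \<omega> = l ! i) \<longrightarrow> X (n + 1) \<omega> = l ! n + 1 \<or> X (n + 1) \<omega> + 1 = l ! n"
    unfolding AE_all_countable using atom by blast
  then show ?thesis
  proof (rule AE_mp, intro AE_I2 impI)
    fix \<omega>
    assume *: "\<forall>l::nat list. (\<forall>i\<le>n. X i \<omega> = l ! i) \<longrightarrow> X (n + 1) \<omega> = l ! n + 1 \<or> X (n + 1) \<omega> + 1 = l ! n"
    show "X (n + 1) \<omega> = X n \<omega> + 1 \<or> X (n + 1) \<omega> + 1 = X n \<omega>"
      using *[rule_format, of "map (\<lambda>i. X i \<omega>) [0..<Suc n]"] by (auto simp: nth_append simp del: upt_Suc)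
  qed
qed

lemma AE_start: "AE \<omega> in M. X 0 \<omega> = 0"
  using start by (subst (asm) prob_Collect_eq_1) auto

lemma AE_le_time: "AE \<omega> in M. \<forall>n. X n \<omega> \<le> n"
proof -
  have "AE \<omega> in M. \<forall>n. X (n + 1) \<omega> = X n \<omega> + 1 \<or> X (n + 1) \<omega> + 1 = X n \<omega>"
    using AE_step by (simp add: AE_all_countable)
  with AE_start show ?thesis
  proof eventually_elim
    case (elim \<omega>)
    show ?case
    proof
      fix n show "X n \<omega> \<le> n"
      proof (induction n)
        case (Suc n)
        then show ?case using elim(2)[rule_format, of n] by auto
      qed (use elim in simp)
    qed
  qed
qed

text \<open>
  Up to time \<open>n\<close> the walk stays in \<open>{0..n}\<close>, so integrability never is an issue, whatever \<open>h\<close> is.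
\<close>
lemma integrable_walk: "integrable M (\<lambda>\<omega>. indicator (cylinder m A) \<omega> * (h (X n \<omega>) :: real))"
proof (rule integrable_const_bound)
  show "AE \<omega> in M. norm (indicator (cylinder m A) \<omega> * h (X n \<omega>)) \<le> (\<Sum>x\<le>n. \<bar>h x\<bar>)"
    using AE_le_time
  proof eventually_elim
    case (elim \<omega>)
    have "\<bar>h (X n \<omega>)\<bar> \<le> (\<Sum>x\<le>n. \<bar>h x\<bar>)"
      by (rule member_le_sum) (use elim in auto)
    moreover have "0 \<le> (\<Sum>x\<le>n. \<bar>h x\<bar>)" by (simp add: sum_nonneg)
    ultimately show ?case by (auto simp: indicator_def)
  qed
qed measurable

lemma integral_walk_shift:
  fixes h :: "nat \<Rightarrow> real"
  shows "(LINT \<omega>|M. indicator (cylinder m A) \<omega> * (h (X n \<omega>) + r)) =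
    (LINT \<omega>|M. indicator (cylinder m A) \<omega> * h (X n \<omega>)) + r * measure M (cylinder m A)"
  using Bochner_Integration.integral_add[OF integrable_walk[of m A h n] integrable_walk[of m A "\<lambda>_. r" n]]
  by (simp add: distrib_left mult.commute[of r])

lemma integral_step_atom:
  fixes n p and h :: "nat \<Rightarrow> real"
  defines "u \<equiv> up_prob c 0 p n" and "H \<equiv> cylinder n (\<lambda>i. {p i})"
  shows "(LINT \<omega>|M. indicator H \<omega> * h (X (n + 1) \<omega>)) =
    measure M H * (u * h (p n + 1) + (1 - u) * h (p n - 1))"
proof -
  let ?U = "{\<omega> \<in> space M. X (n + 1) \<omega> = p n + 1 \<and> (\<forall>i\<le>n. X i \<omega> = p i)}"
  let ?D = "{\<omega> \<in> space M. X (n + 1) \<omega> + 1 = p n \<and> (\<forall>i\<le>n. X i \<omega> = p i)}"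
  have H: "H = {\<omega> \<in> space M. \<forall>i\<le>n. X i \<omega> = p i}" by (simp add: H_def cylinder_def)
  have "(LINT \<omega>|M. indicator H \<omega> * h (X (n + 1) \<omega>)) =
      (LINT \<omega>|M. h (p n + 1) * indicator ?U \<omega> + h (p n - 1) * indicator ?D \<omega>)"
  proof (rule integral_cong_AE)
    show "AE \<omega> in M. indicator H \<omega> * h (X (n + 1) \<omega>) =
        h (p n + 1) * indicator ?U \<omega> + h (p n - 1) * indicator ?D \<omega>"
      using AE_step[of n] AE_space
    proof eventually_elim
      case (elim \<omega>)
      have "X (n + 1) \<omega> = p n - 1" if "\<omega> \<in> ?D" using that by auto
      then show ?case using elim unfolding H by (auto simp: indicator_def)
    qed
  qed (unfold H, measurable)
  also have "\<dots> = h (p n + 1) * measure M ?U + h (p n - 1) * measure M ?D"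
    by (subst Bochner_Integration.integral_add) (auto intro!: integrable_mult_right simp: emeasure_eq_measure)
  also have "\<dots> = measure M H * (u * h (p n + 1) + (1 - u) * h (p n - 1))"
    unfolding step_joint H u_def by (simp add: algebra_simps)
  finally show ?thesis .
qed

text \<open>
  The martingale property of \<open>g (X n) - n\<close>, tested on the events that are used below.  By
  \<open>AE_le_time\<close> a cylinder splits, up to a null set, into finitely many single histories, and on each of
  them the identity is \<open>hit_time_drift\<close>.
\<close>
lemma drift:
  "(LINT \<omega>|M. indicator (cylinder n A) \<omega> * g (X (n + 1) \<omega>)) =
   (LINT \<omega>|M. indicator (cylinder n A) \<omega> * (g (X n \<omega>) + 1))"
proof -
  let ?P = "PiE {..n} (\<lambda>i. A i \<inter> {..i})"
  let ?H = "\<lambda>p. cylinder n (\<lambda>i. {p i})"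
  have fin: "finite ?P" by (rule finite_PiE) auto
  have part: "AE \<omega> in M. indicator (cylinder n A) \<omega> = (\<Sum>p\<in>?P. indicator (?H p) \<omega> :: real)"
    using AE_le_time AE_space
  proof eventually_elim
    case (elim \<omega>)
    let ?q = "restrict (\<lambda>i. X i \<omega>) {..n}"
    have eq: "\<omega> \<in> ?H p \<longleftrightarrow> p = ?q" if "p \<in> ?P" for p
      using that elim by (auto simp: cylinder_def PiE_iff extensional_def fun_eq_iff restrict_def)
    have "(\<Sum>p\<in>?P. indicator (?H p) \<omega>) = (\<Sum>p\<in>?P. if p = ?q then 1 else 0 :: real)"
      by (rule sum.cong) (auto simp: indicator_def eq)
    also have "\<dots> = indicator (cylinder n A) \<omega>"
      using elim fin by (auto simp: cylinder_def indicator_def PiE_iff)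
    finally show ?case by simp
  qed
  have split: "(LINT \<omega>|M. indicator (cylinder n A) \<omega> * h (X m \<omega>)) =
      (\<Sum>p\<in>?P. LINT \<omega>|M. indicator (?H p) \<omega> * h (X m \<omega>))" for h :: "nat \<Rightarrow> real" and m
  proof -
    have "(LINT \<omega>|M. indicator (cylinder n A) \<omega> * h (X m \<omega>)) =
        (LINT \<omega>|M. (\<Sum>p\<in>?P. indicator (?H p) \<omega> * h (X m \<omega>)))"
      by (rule integral_cong_AE) (measurable, use part in \<open>auto elim!: AE_mp simp: sum_distrib_right\<close>)
    also have "\<dots> = (\<Sum>p\<in>?P. LINT \<omega>|M. indicator (?H p) \<omega> * h (X m \<omega>))"
      by (rule Bochner_Integration.integral_sum) (rule integrable_walk)
    finally show ?thesis .
  qed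
  have atom: "(LINT \<omega>|M. indicator (?H p) \<omega> * g (X (n + 1) \<omega>)) =
      (LINT \<omega>|M. indicator (?H p) \<omega> * (g (X n \<omega>) + 1))" for p
  proof -
    have "(LINT \<omega>|M. indicator (?H p) \<omega> * (g (X n \<omega>) + 1)) =
        (LINT \<omega>|M. indicator (?H p) \<omega> * (g (p n) + 1))"
      by (rule Bochner_Integration.integral_cong) (auto simp: cylinder_def indicator_def)
    also have "\<dots> = measure M (?H p) * (g (p n) + 1)" by simp
    also have "g (p n) + 1 = up_prob c 0 p n * g (p n + 1) + (1 - up_prob c 0 p n) * g (p n - 1)"
      by (rule hit_time_drift[symmetric]) (rule weight_pos up_prob_unreinforced)+
    finally show ?thesis
      using integral_step_atom[where p=p and n=n and h=g] by simp
  qed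
  show ?thesis
    using split[of g "n + 1"] split[of "\<lambda>x. g x + 1" n] atom by simp
qed

section \<open>Almost sure comparison of the hitting-time function with time\<close>

text \<open>
  Freeze the walk when \<open>g (X k)\<close> first reaches \<open>\<mu>\<close>, and count the frozen value as \<open>\<mu>\<close>.  The mean \<open>b n n\<close> of the
  resulting process grows by at most \<open>1\<close> per step, since replacing the value at the crossing by \<open>\<mu>\<close>
  only lowers it; and it is at least \<open>\<mu>\<close> times the probability of having been frozen.
\<close>
lemma maximal_inequality:
  assumes "\<mu> > 0"
  shows "\<P>(\<omega> in M. \<exists>k\<le>n. \<mu> \<le> g (X k \<omega>)) \<le> real n / \<mu>"
proof -
  define A where "A n = cylinder n (\<lambda>_. {x. g x < \<mu>})" for n
  have [measurable]: "A n \<in> sets M" for n by (simp add: A_def)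
  have int: "integrable M (\<lambda>\<omega>. indicator (A n) \<omega> * h (X m \<omega>))" for n m and h :: "nat \<Rightarrow> real"
    unfolding A_def by (rule integrable_walk)
  have int1: "integrable M (\<lambda>\<omega>. indicator (A n) \<omega> :: real)" for n
    using int[of n "\<lambda>_. 1"] by simp
  define b where "b n m = (LINT \<omega>|M. indicator (A n) \<omega> * g (X m \<omega>) + \<mu> * (1 - indicator (A n) \<omega>))" for n m
  have b_eq: "b n m = (LINT \<omega>|M. indicator (A n) \<omega> * g (X m \<omega>)) + \<mu> * (1 - measure M (A n))" for n m
    unfolding b_def using int int1 by (simp add: prob_space)
  have b_le: "b n n \<le> real n" for n
  proof (induction n)
    case 0
    have "b 0 0 = (LINT \<omega>|M. 0)"
      unfolding b_def
    proof (rule integral_cong_AE)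
      show "AE \<omega> in M. indicator (A 0) \<omega> * g (X 0 \<omega>) + \<mu> * (1 - indicator (A 0) \<omega>) = 0"
        using AE_start AE_space
        by eventually_elim (use assms in \<open>auto simp: A_def cylinder_def\<close>)
    qed measurable
    then show ?case by simp
  next
    case (Suc n)
    have "b (Suc n) (Suc n) \<le> b n (Suc n)"
      unfolding b_def
    proof (rule integral_mono)
      fix \<omega> assume "\<omega> \<in> space M"
      then show "indicator (A (Suc n)) \<omega> * g (X (Suc n) \<omega>) + \<mu> * (1 - indicator (A (Suc n)) \<omega>)
          \<le> indicator (A n) \<omega> * g (X (Suc n) \<omega>) + \<mu> * (1 - indicator (A n) \<omega>)"
        by (auto simp: A_def cylinder_def indicator_def le_Suc_eq)
    qed (use int int1 in auto)
    also have "b n (Suc n) = (LINT \<omega>|M. indicator (A n) \<omega> * (g (X n \<omega>) + 1)) + \<mu> * (1 - measure M (A n))"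
      unfolding b_eq A_def using drift[of n] by simp
    also have "(LINT \<omega>|M. indicator (A n) \<omega> * (g (X n \<omega>) + 1)) =
        (LINT \<omega>|M. indicator (A n) \<omega> * g (X n \<omega>)) + measure M (A n)"
      unfolding A_def integral_walk_shift by simp
    also have "\<dots> + \<mu> * (1 - measure M (A n)) = b n n + measure M (A n)"
      unfolding b_eq by simp
    also have "\<dots> \<le> real (Suc n)" using add_mono[OF Suc prob_le_1[of "A n"]] by simp
    finally show ?case .
  qed
  have "0 \<le> (LINT \<omega>|M. indicator (A n) \<omega> * g (X n \<omega>))"
    by (rule integral_nonneg_AE) (auto simp: g_nonneg)
  then have "\<mu> * (1 - measure M (A n)) \<le> real n"
    using b_le[of n] unfolding b_eq by linarith
  moreover have "1 - measure M (A n) = \<P>(\<omega> in M. \<exists>k\<le>n. \<mu> \<le> g (X k \<omega>))"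
    by (subst prob_compl[symmetric]) (auto intro!: arg_cong[where f="measure M"] simp: A_def cylinder_def not_le not_less)
  ultimately show ?thesis using assms by (simp add: field_simps)
qed

text \<open>
  At the scale \<open>2\<^sup>j\<close> the maximal inequality gives probabilities of order \<open>j\<^bsup>-(1+\<epsilon>)\<^esup>\<close>, which are
  summable.  The maximum up to \<open>2\<^bsup>j+1\<^esup>\<close> is compared with the level at \<open>2\<^sup>j\<close>, so that the
  whole dyadic block is covered.
\<close>
lemma AE_hit_time_upper:
  assumes "\<epsilon> > 0"
  shows "AE \<omega> in M. (\<lambda>n. g (X n \<omega>) / (real n * ln (real n) powr (1 + \<epsilon>))) \<longlonglongrightarrow> 0"
proof -
  have ev: "AE \<omega> in M. \<forall>\<^sub>F n in sequentially. g (X n \<omega>) \<le> \<delta> * (real n * ln (real n) powr (1 + \<epsilon>))"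
    if "\<delta> > 0" for \<delta>
  proof -
    define \<mu> where "\<mu> j = \<delta> * (2 ^ j * ln (2 ^ j) powr (1 + \<epsilon>))" for j :: nat
    define E where "E j = {\<omega> \<in> space M. \<exists>k\<le>2 ^ (j + 1). \<mu> j \<le> g (X k \<omega>)}" for j
    have [measurable]: "E j \<in> sets M" for j unfolding E_def by measurable
    have "summable (\<lambda>j. measure M (E j))"
    proof (rule summable_comparison_test_ev)
      show "summable (\<lambda>j. 2 / (\<delta> * ln 2 powr (1 + \<epsilon>)) * real j powr - (1 + \<epsilon>))"
        by (rule summable_mult) (use assms in \<open>simp add: summable_real_powr_iff\<close>)
      show "\<forall>\<^sub>F j in sequentially. norm (measure M (E j)) \<le> 2 / (\<delta> * ln 2 powr (1 + \<epsilon>)) * real j powr - (1 + \<epsilon>)"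
        using eventually_gt_at_top[of 0]
      proof eventually_elim
        case (elim j)
        have "\<mu> j > 0" using elim that by (simp add: \<mu>_def ln_realpow)
        from maximal_inequality[OF this, of "2 ^ (j + 1)"]
        have "measure M (E j) \<le> 2 ^ (j + 1) / \<mu> j" by (simp add: E_def)
        also have "\<dots> = 2 / (\<delta> * ln 2 powr (1 + \<epsilon>)) * real j powr - (1 + \<epsilon>)"
          using elim that powr_minus[of "real j" "1 + \<epsilon>"]
          by (simp add: \<mu>_def ln_realpow powr_mult field_simps)
        finally show ?case by simp
      qed
    qed
    then have "AE \<omega> in M. \<forall>\<^sub>F j in sequentially. \<omega> \<in> space M - E j"
      by (intro borel_cantelli_AE1) (auto simp: emeasure_eq_measure)
    then show ?thesis
    proof eventually_elim
      case (elim \<omega>)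
      then obtain J where J: "\<And>j. j \<ge> J \<Longrightarrow> \<omega> \<in> space M - E j"
        by (auto simp: eventually_sequentially)
      show ?case
      proof (rule eventually_sequentiallyI)
        fix n :: nat assume n: "2 ^ J \<le> n"
        then have "n \<ge> 1" using order_trans[of 1 "2 ^ J" n] by simp
        then obtain j where j: "2 ^ j \<le> n" "n < 2 ^ (j + 1)"
          using ex_power_ivl1[of 2 n] by auto
        have "J < j + 1"
          by (rule power_less_imp_less_exp[of "2::nat"]) (use n j in linarith)+
        then have "g (X n \<omega>) < \<mu> j"
          using J[of j] j by (auto simp: E_def not_le dest!: spec[of _ n])
        also have "\<mu> j \<le> \<delta> * (real n * ln (real n) powr (1 + \<epsilon>))"
        proof -
          have r: "2 ^ j \<le> real n" using j(1) by (metis of_nat_le_iff of_nat_numeral of_nat_power)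
          then have "ln (2 ^ j) \<le> ln (real n)" using \<open>n \<ge> 1\<close> by (intro ln_mono) auto
          then have "ln (2 ^ j) powr (1 + \<epsilon>) \<le> ln (real n) powr (1 + \<epsilon>)"
            using assms by (intro powr_mono2) auto
          then show ?thesis
            unfolding \<mu>_def using that r by (intro mult_mono) auto
        qed
        finally show "g (X n \<omega>) \<le> \<delta> * (real n * ln (real n) powr (1 + \<epsilon>))" by simp
      qed
    qed
  qed
  have "AE \<omega> in M. \<forall>i::nat. \<forall>\<^sub>F n in sequentially.
      g (X n \<omega>) \<le> inverse (real (Suc i)) * (real n * ln (real n) powr (1 + \<epsilon>))"
    unfolding AE_all_countable using ev by simp
  then show ?thesis
  proof eventually_elim
    case (elim \<omega>)
    show ?case
    proof (rule tendstoI)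
      fix e :: real assume "e > 0"
      then obtain i where i: "inverse (real (Suc i)) < e" using reals_Archimedean by blast
      from elim[rule_format, of i] eventually_gt_at_top[of 1]
      show "\<forall>\<^sub>F n in sequentially. dist (g (X n \<omega>) / (real n * ln (real n) powr (1 + \<epsilon>))) 0 < e"
      proof eventually_elim
        case (elim n)
        then have pos: "real n * ln (real n) powr (1 + \<epsilon>) > 0" by simp
        have "g (X n \<omega>) / (real n * ln (real n) powr (1 + \<epsilon>)) \<le> inverse (real (Suc i))"
          using elim(1) pos by (simp only: pos_divide_le_eq)
        then show ?case using i g_nonneg[of "X n \<omega>"] pos by simp
      qed
    qed
  qed
qed

text \<open>
  On \<open>A n\<close> the bound \<open>g (X k) \<le> \<delta> k\<close> has held for \<open>m \<le> k \<le> n\<close>.  The restricted mean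
  \<open>a n n\<close> of \<open>g (X n) - n\<close> over \<open>A n\<close> does not decrease in \<open>n\<close>: the martingale identity
  carries it to \<open>a n (n + 1)\<close>, and the paths leaving \<open>A n\<close> at time \<open>n + 1\<close> take away a
  nonpositive contribution.  It starts from at least \<open>- m\<close> and is at most \<open>- (n / 2) * P (A n)\<close>.
\<close>
lemma AE_hit_time_lower:
  assumes growth: "\<And>x. g (Suc x) \<le> K * (g x + 1)" and K: "K \<ge> 1"
  shows "AE \<omega> in M. \<exists>\<^sub>F n in sequentially. g (X n \<omega>) > 1 / (2 * K) * real n"
proof -
  define \<delta> where "\<delta> = 1 / (2 * K)"
  have \<delta>: "\<delta> \<le> 1 / 2" unfolding \<delta>_def using K by (intro divide_left_mono) auto
  have once: "AE \<omega> in M. \<exists>n\<ge>m. g (X n \<omega>) > \<delta> * real n" if m: "real m \<ge> 2 * K" for m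
  proof -
    define A where "A n = cylinder n (\<lambda>k. {x. m \<le> k \<longrightarrow> g x \<le> \<delta> * real k})" for n
    have [measurable]: "A n \<in> sets M" for n by (simp add: A_def)
    have int: "integrable M (\<lambda>\<omega>. indicator (A n) \<omega> * h (X m \<omega>))" for n m and h :: "nat \<Rightarrow> real"
      unfolding A_def by (rule integrable_walk)
    define a where "a n k = (LINT \<omega>|M. indicator (A n) \<omega> * (g (X k \<omega>) - real k))" for n k
    have a_ge: "- real m \<le> a n n" if "m \<le> n" for n
      using that
    proof (induction n rule: dec_induct)
      case base
      have "(LINT \<omega>|M. - real m) \<le> a m m"
        unfolding a_def
        by (rule integral_mono) (use int[of m "\<lambda>x. g x - real m" m] g_nonneg in \<open>simp_all add: indicator_def\<close>)
      then show ?case by (simp add: prob_space)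
    next
      case (step n)
      have "a n n = a n (Suc n)"
      proof -
        have shift: "a n k = (LINT \<omega>|M. indicator (A n) \<omega> * g (X k \<omega>)) - real k * measure M (A n)" for k
          unfolding a_def A_def
          using integral_walk_shift[where r="- real k" and h=g and n=k] by simp
        have "(LINT \<omega>|M. indicator (A n) \<omega> * g (X (Suc n) \<omega>)) =
            (LINT \<omega>|M. indicator (A n) \<omega> * g (X n \<omega>)) + measure M (A n)"
          using drift[of n] unfolding A_def integral_walk_shift by simp
        then show ?thesis unfolding shift by (simp add: algebra_simps)
      qed
      also have "a n (Suc n) \<le> a (Suc n) (Suc n)"
        unfolding a_def
      proof (rule integral_mono_AE)
        show "AE \<omega> in M. indicator (A n) \<omega> * (g (X (Suc n) \<omega>) - real (Suc n))
            \<le> indicator (A (Suc n)) \<omega> * (g (X (Suc n) \<omega>) - real (Suc n))"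
          using AE_step[of n] AE_space
        proof eventually_elim
          case (elim \<omega>)
          \<comment> \<open>The overshoot: the choice of \<open>\<delta>\<close> gives \<open>K * \<delta> * n = n / 2\<close>, and \<open>m \<ge> 2 * K\<close> absorbs the constant \<open>K\<close>.\<close>
          have "g (X (Suc n) \<omega>) \<le> real (Suc n)" if "\<omega> \<in> A n"
          proof -
            have "g (X (Suc n) \<omega>) \<le> g (Suc (X n \<omega>))" by (rule g_mono) (use elim in auto)
            also have "\<dots> \<le> K * (g (X n \<omega>) + 1)" by (rule growth)
            also have "\<dots> \<le> K * (\<delta> * real n + 1)"
              using that step(1) K by (intro mult_left_mono) (auto simp: A_def cylinder_def)
            also have "\<dots> = real n / 2 + K" using K by (simp add: \<delta>_def field_simps)
            also have "\<dots> \<le> real (Suc n)" using m step(1) by simp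
            finally show ?thesis .
          qed
          then show ?case
            using elim by (auto simp: indicator_def A_def cylinder_def)
        qed
      qed (use int[of _ "\<lambda>x. g x - real (Suc n)" "Suc n"] in blast)+
      finally show ?case using step.IH by linarith
    qed
    have A_le: "measure M (A n) \<le> 2 * real m / real n" if "m \<le> n" for n
    proof -
      have "m > 0" using m K by (cases m) auto
      have "a n n \<le> (LINT \<omega>|M. indicator (A n) \<omega> * (- (real n / 2)))"
        unfolding a_def
      proof (rule integral_mono)
        fix \<omega> assume "\<omega> \<in> space M"
        have "g (X n \<omega>) - real n \<le> - (real n / 2)" if "\<omega> \<in> A n"
        proof -
          have "g (X n \<omega>) \<le> \<delta> * real n" using that \<open>m \<le> n\<close> by (auto simp: A_def cylinder_def)
          also have "\<dots> \<le> 1 / 2 * real n" by (rule mult_right_mono[OF \<delta>]) simp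
          finally show ?thesis by simp
        qed
        then show "indicator (A n) \<omega> * (g (X n \<omega>) - real n) \<le> indicator (A n) \<omega> * (- (real n / 2))"
          by (auto simp: indicator_def)
      qed (rule int[of _ "\<lambda>x. g x - real n" n] int[of _ "\<lambda>x. - (real n / 2)" n])+
      also have "\<dots> = - (real n / 2) * measure M (A n)" by simp
      finally show ?thesis using a_ge[OF that] \<open>m > 0\<close> that by (simp add: field_simps)
    qed
    define B where "B = {\<omega> \<in> space M. \<forall>n\<ge>m. g (X n \<omega>) \<le> \<delta> * real n}"
    have [measurable]: "B \<in> sets M" unfolding B_def by measurable
    have "measure M B \<le> 0"
    proof (rule LIMSEQ_le_const)
      show "(\<lambda>n. 2 * real m / real n) \<longlonglongrightarrow> 0" by (rule lim_const_over_n)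
      have "measure M B \<le> 2 * real m / real n" if "m \<le> n" for n
      proof -
        have "measure M B \<le> measure M (A n)"
          by (rule finite_measure_mono) (auto simp: B_def A_def cylinder_def)
        with A_le[OF that] show ?thesis by simp
      qed
      then show "\<exists>N. \<forall>n\<ge>N. measure M B \<le> 2 * real m / real n" by blast
    qed
    then have "B \<in> null_sets M"
      by (auto simp: null_sets_def emeasure_eq_measure measure_le_0_iff)
    then show ?thesis
      by (rule AE_not_in[THEN AE_mp]) (auto simp: B_def not_le)
  qed
  obtain m0 :: nat where m0: "real m0 \<ge> 2 * K" using real_arch_simple by blast
  have "AE \<omega> in M. \<forall>m. \<exists>n\<ge>m0 + m. g (X n \<omega>) > \<delta> * real n"
    unfolding AE_all_countable using once m0 by simp
  then show ?thesis
  proof eventually_elim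
    case (elim \<omega>)
    then show ?case
      unfolding frequently_sequentially \<delta>_def[symmetric] by (meson add_leE)
  qed
qed

end

section \<open>Hitting times for power weights\<close>

lemma powr_increment:
  assumes "x \<ge> 1"
  obtains z where "real x \<le> z" "z \<le> real (Suc x)"
    "real (Suc x) powr a - real x powr a = a * z powr (a - 1)"
proof -
  have "\<exists>z>real x. z < real (Suc x) \<and>
      real (Suc x) powr a - real x powr a = (real (Suc x) - real x) * (a * z powr (a - 1))"
    by (rule MVT2) (use assms in \<open>auto intro!: has_real_derivative_powr\<close>)
  then obtain z where "real x < z" "z < real (Suc x)"
    "real (Suc x) powr a - real x powr a = (real (Suc x) - real x) * (a * z powr (a - 1))"
    by blast
  then show thesis by (intro that[of z]) auto
qed

lemma sum_powr_ge:
  assumes "b \<ge> 0"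
  shows "real x powr (b + 1) / (b + 1) \<le> (\<Sum>y<x. real (Suc y) powr b)"
proof (induction x)
  case (Suc x)
  have "real (Suc x) powr (b + 1) - real x powr (b + 1) \<le> (b + 1) * real (Suc x) powr b"
  proof (cases "x = 0")
    case False
    then obtain z where z: "real x \<le> z" "z \<le> real (Suc x)"
      "real (Suc x) powr (b + 1) - real x powr (b + 1) = (b + 1) * z powr b"
      using powr_increment[of x "b + 1"] by auto
    with assms show ?thesis by (auto intro!: mult_left_mono powr_mono2)
  qed (use assms in simp)
  then have "real (Suc x) powr (b + 1) / (b + 1) \<le> real x powr (b + 1) / (b + 1) + real (Suc x) powr b"
    using assms divide_right_mono[of "real (Suc x) powr (b + 1) - real x powr (b + 1)"
      "(b + 1) * real (Suc x) powr b" "b + 1"]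
    by (simp add: diff_divide_distrib)
  with Suc show ?case by simp
qed simp

text \<open>
  For \<open>t < 1\<close> the exponent is negative and each term is dominated by an increment of \<open>x\<^sup>t / t\<close>.  The
  constant is chosen to serve the case \<open>t \<ge> 1\<close> as well.
\<close>
lemma sum_powr_le:
  assumes "t > 0"
  shows "(\<Sum>y<x. real (Suc y) powr (t - 1)) \<le> (1 + 1 / t) * real x powr t"
proof (cases "t \<ge> 1")
  case True
  have "(\<Sum>y<x. real (Suc y) powr (t - 1)) \<le> (\<Sum>y<x. real x powr (t - 1))"
    by (rule sum_mono) (use True in \<open>auto intro!: powr_mono2\<close>)
  also have "\<dots> = 1 * real x powr t"
    by (cases "x = 0") (auto simp: powr_diff)
  also have "\<dots> \<le> (1 + 1 / t) * real x powr t"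
    by (rule mult_right_mono) (use assms in auto)
  finally show ?thesis .
next
  case False
  have "(\<Sum>y<x. real (Suc y) powr (t - 1)) \<le> 1 / t * real x powr t"
  proof (induction x)
    case (Suc x)
    have "t * real (Suc x) powr (t - 1) \<le> real (Suc x) powr t - real x powr t"
    proof (cases "x = 0")
      case False
      then obtain z where z: "real x \<le> z" "z \<le> real (Suc x)"
        "real (Suc x) powr t - real x powr t = t * z powr (t - 1)"
        using powr_increment[of x t] by auto
      with assms False \<open>\<not> t \<ge> 1\<close> show ?thesis
        by (auto intro!: mult_left_mono powr_mono2')
    qed (use \<open>\<not> t \<ge> 1\<close> in simp)
    then have "real (Suc x) powr (t - 1) \<le> 1 / t * real (Suc x) powr t - 1 / t * real x powr t"
      using assms by (simp add: field_simps)
    with Suc show ?case by simp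
  qed simp
  also have "\<dots> \<le> (1 + 1 / t) * real x powr t"
    by (rule mult_right_mono) auto
  finally show ?thesis .
qed

definition power_weight :: "real \<Rightarrow> nat \<Rightarrow> real" where
  "power_weight \<alpha> x = (if x = 0 then 1 else real x powr \<alpha>)"

lemma power_weight_pos: "power_weight \<alpha> x > 0"
  by (simp add: power_weight_def)

lemma power_weight_ratio:
  "power_weight \<alpha> (Suc x) \<le> 2 powr \<bar>\<alpha>\<bar> * power_weight \<alpha> x"
  "power_weight \<alpha> x \<le> 2 powr \<bar>\<alpha>\<bar> * power_weight \<alpha> (Suc x)"
proof -
  have two: "1 \<le> 2 powr \<bar>\<alpha>\<bar>" by (simp add: ge_one_powr_ge_zero)
  have *: "u powr \<alpha> \<le> 2 powr \<bar>\<alpha>\<bar> * v powr \<alpha>" if "0 < u" "u \<le> 2 * v" "v \<le> 2 * u" for u v :: real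
  proof (cases "\<alpha> \<ge> 0")
    case True
    then have "u powr \<alpha> \<le> (2 * v) powr \<alpha>" using that by (intro powr_mono2) auto
    then show ?thesis using True that by (simp add: powr_mult)
  next
    case False
    then have "(2 * u) powr \<alpha> \<le> v powr \<alpha>" using that by (intro powr_mono2') auto
    then have "2 powr \<bar>\<alpha>\<bar> * (2 powr \<alpha> * u powr \<alpha>) \<le> 2 powr \<bar>\<alpha>\<bar> * v powr \<alpha>"
      using that by (simp add: powr_mult)
    moreover have "2 powr \<bar>\<alpha>\<bar> * (2 powr \<alpha> * u powr \<alpha>) = u powr \<alpha>"
      using False by (simp add: powr_minus)
    ultimately show ?thesis by simp
  qed
  show "power_weight \<alpha> (Suc x) \<le> 2 powr \<bar>\<alpha>\<bar> * power_weight \<alpha> x"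
    using *[of "real (Suc x)" "real x"] two by (cases "x = 0") (auto simp: power_weight_def)
  show "power_weight \<alpha> x \<le> 2 powr \<bar>\<alpha>\<bar> * power_weight \<alpha> (Suc x)"
    using *[of "real x" "real (Suc x)"] two by (cases "x = 0") (auto simp: power_weight_def)
qed

lemma mass_le:
  assumes "\<And>x. c x > 0"
  shows "mass c x \<le> 2 * (c 0 + (\<Sum>y<x. c (Suc y)))"
  using sum.lessThan_Suc_shift[of c x] assms[of x] by (simp add: mass_def)

text \<open>
  The choice \<open>\<theta> = 1 + \<alpha>\<close> gives the true order when \<open>\<alpha> > -1\<close>; at \<open>\<alpha> = -1\<close> a small \<open>\<theta> > 0\<close> bounds
  the logarithm by a power.
\<close>
lemma mass_power_weight_le:
  assumes "\<theta> > 0" "1 + \<alpha> \<le> \<theta>" "x \<ge> 1"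
  shows "mass (power_weight \<alpha>) x \<le> 2 * (2 + 1 / \<theta>) * real x powr \<theta>"
proof -
  have "(\<Sum>y<x. power_weight \<alpha> (Suc y)) \<le> (\<Sum>y<x. real (Suc y) powr (\<theta> - 1))"
    by (rule sum_mono) (use assms in \<open>auto simp: power_weight_def intro!: powr_mono\<close>)
  also have "\<dots> \<le> (1 + 1 / \<theta>) * real x powr \<theta>" by (rule sum_powr_le[OF assms(1)])
  finally have "mass (power_weight \<alpha>) x \<le> 2 * (1 + (1 + 1 / \<theta>) * real x powr \<theta>)"
    using mass_le[of "power_weight \<alpha>" x, OF power_weight_pos] by (simp add: power_weight_def)
  moreover have "1 \<le> real x powr \<theta>" using assms by (simp add: ge_one_powr_ge_zero)
  ultimately show ?thesis by (simp add: algebra_simps)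
qed

lemma mass_power_weight_bounded:
  assumes "\<alpha> < -1"
  obtains C where "C \<ge> 0" "\<And>x. mass (power_weight \<alpha>) x \<le> C"
proof
  have sm: "summable (\<lambda>y. real y powr \<alpha>)" using assms by (simp add: summable_real_powr_iff)
  then have sm': "summable (\<lambda>y. real (Suc y) powr \<alpha>)" by (subst summable_Suc_iff)
  show "0 \<le> 2 * (1 + (\<Sum>y. real (Suc y) powr \<alpha>))"
    using suminf_nonneg[OF sm'] by simp
  show "mass (power_weight \<alpha>) x \<le> 2 * (1 + (\<Sum>y. real (Suc y) powr \<alpha>))" for x
    using sum_le_suminf[OF sm', of "{..<x}"] mass_le[of "power_weight \<alpha>" x, OF power_weight_pos]
    by (simp add: power_weight_def)
qed

lemma hit_time_le:
  assumes mass: "\<And>x. x \<ge> 1 \<Longrightarrow> mass (power_weight \<alpha>) x \<le> C * real x powr \<theta>"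
    and "C \<ge> 0" "\<alpha> \<le> \<theta>"
  shows "hit_time (power_weight \<alpha>) x \<le> (1 + C) * real x powr (1 + \<theta> - \<alpha>)"
proof (cases "x = 0")
  case False
  have "mass (power_weight \<alpha>) y / power_weight \<alpha> y \<le> (1 + C) * real x powr (\<theta> - \<alpha>)" if "y < x" for y
  proof (cases "y = 0")
    case True
    have "1 * 1 \<le> (1 + C) * real x powr (\<theta> - \<alpha>)"
      using assms False by (intro mult_mono) (auto simp: ge_one_powr_ge_zero)
    then show ?thesis using True by (simp add: mass_def power_weight_def)
  next
    case False
    then have "mass (power_weight \<alpha>) y / power_weight \<alpha> y \<le> C * real y powr \<theta> / real y powr \<alpha>"
      using mass[of y] by (simp add: power_weight_def divide_right_mono)
    also have "\<dots> = C * real y powr (\<theta> - \<alpha>)" by (simp add: powr_diff)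
    also have "\<dots> \<le> (1 + C) * real x powr (\<theta> - \<alpha>)"
      using assms that by (intro mult_mono powr_mono2) auto
    finally show ?thesis .
  qed
  then have "hit_time (power_weight \<alpha>) x \<le> (\<Sum>y<x. (1 + C) * real x powr (\<theta> - \<alpha>))"
    unfolding hit_time_def by (intro sum_mono) auto
  also have "\<dots> = (1 + C) * real x powr (1 + \<theta> - \<alpha>)"
    using False by (simp add: powr_add powr_diff)
  finally show ?thesis .
qed simp

lemma hit_time_ge:
  assumes weight_ratio: "\<And>y. \<kappa> * real (Suc y) powr b \<le> mass c y / c y" and "\<kappa> > 0" "b \<ge> 0"
  shows "\<kappa> / (b + 1) * real x powr (b + 1) \<le> hit_time c x"
proof -
  have "\<kappa> / (b + 1) * real x powr (b + 1) \<le> \<kappa> * (\<Sum>y<x. real (Suc y) powr b)"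
    using mult_left_mono[OF sum_powr_ge[of b x], of \<kappa>] assms by simp
  also have "\<dots> \<le> hit_time c x"
    unfolding hit_time_def sum_distrib_left by (intro sum_mono weight_ratio)
  finally show ?thesis .
qed

text \<open>
  As \<open>\<alpha> \<le> 1\<close>, weights are at least linear in relative terms, \<open>c y / c x \<ge> y / x\<close> for \<open>y \<le> x\<close>.  Summing
  over \<open>y \<le> x\<close>, the increment of \<open>hit_time\<close> at \<open>x\<close> is at least \<open>(x + 1) / 2\<close>.
\<close>
lemma hit_time_ge_square:
  assumes "\<alpha> \<le> 1"
  shows "1 / 4 * real x powr 2 \<le> hit_time (power_weight \<alpha>) x"
proof -
  have "1 / 2 * real (Suc x) powr 1 \<le> mass (power_weight \<alpha>) x / power_weight \<alpha> x" for x
  proof (cases "x = 0")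
    case False
    let ?c = "power_weight \<alpha>"
    have cmp: "real y / real x * ?c x \<le> ?c y" if "y \<le> x" for y
    proof (cases "y = 0")
      case False
      have "(real y / real x) powr 1 \<le> (real y / real x) powr \<alpha>"
        using False that assms by (intro powr_mono') auto
      then show ?thesis using False \<open>x \<noteq> 0\<close>
        by (simp add: power_weight_def powr_divide field_simps)
    qed (simp add: power_weight_def)
    have "real (Suc x) / 2 * ?c x = (\<Sum>y<Suc x. real y / real x * ?c x)"
    proof -
      have "(\<Sum>y<Suc x. real y) = real x * real (Suc x) / 2"
        by (induction x) (auto simp: field_simps)
      then have "(\<Sum>y<Suc x. real y / real x * ?c x) = real x * real (Suc x) / 2 / real x * ?c x"
        by (simp only: flip: sum_divide_distrib sum_distrib_right)
      then show ?thesis using False by simp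
    qed
    also have "\<dots> \<le> (\<Sum>y<Suc x. ?c y)" using cmp by (intro sum_mono) simp
    also have "\<dots> \<le> mass ?c x"
      using sum_nonneg[of "{..<x}" ?c] power_weight_pos[of \<alpha>] by (simp add: mass_def less_imp_le)
    finally show ?thesis using power_weight_pos[of \<alpha> x] by (simp add: field_simps)
  qed (simp add: mass_def power_weight_def)
  from hit_time_ge[OF this, of x] show ?thesis by simp
qed

text \<open>
  Here the mass is bounded below by that of the origin alone, which is sharp in order for \<open>\<alpha> < -1\<close>.
\<close>
lemma hit_time_ge_powr:
  assumes "\<alpha> \<le> 0"
  shows "2 powr \<alpha> / (1 - \<alpha>) * real x powr (1 - \<alpha>) \<le> hit_time (power_weight \<alpha>) x"
proof -
  have "2 powr \<alpha> * real (Suc x) powr (- \<alpha>) \<le> mass (power_weight \<alpha>) x / power_weight \<alpha> x" for x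
  proof -
    let ?c = "power_weight \<alpha>"
    have "2 powr \<alpha> * real (Suc x) powr (- \<alpha>) \<le> 1 / ?c x"
    proof (cases "x = 0")
      case True
      then show ?thesis using assms powr_mono[of \<alpha> 0 "2::real"] by (simp add: power_weight_def)
    next
      case False
      have "real (Suc x) powr (- \<alpha>) \<le> (2 * real x) powr (- \<alpha>)"
        using assms False by (intro powr_mono2) auto
      then show ?thesis using False
        by (simp add: power_weight_def powr_mult powr_minus field_simps)
    qed
    also have "1 \<le> mass ?c x"
    proof (cases "x = 0")
      case False
      have "?c 0 \<le> (\<Sum>y<x. ?c y)"
        by (rule member_le_sum) (use False power_weight_pos[of \<alpha>] in \<open>auto simp: less_imp_le\<close>)
      then show ?thesis using power_weight_pos[of \<alpha> x] by (simp add: mass_def power_weight_def)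
    qed (simp add: mass_def power_weight_def)
    then have "1 / ?c x \<le> mass ?c x / ?c x"
      using power_weight_pos[of \<alpha> x] by (simp add: divide_right_mono less_imp_le)
    finally show ?thesis .
  qed
  from hit_time_ge[OF this, of x] assms show ?thesis by (simp add: add.commute)
qed

section \<open>From the hitting-time function to the position\<close>

lemma upper_scale_transfer:
  fixes u :: "nat \<Rightarrow> nat" and s :: "nat \<Rightarrow> real"
  assumes ge: "\<And>x. \<kappa> * real x powr \<beta> \<le> h x" and "\<kappa> > 0" "\<beta> > 0" "\<And>n. s n \<ge> 0"
    and lim: "(\<lambda>n. h (u n) / s n) \<longlonglongrightarrow> 0"
  shows "(\<lambda>n. real (u n) / s n powr (1 / \<beta>)) \<longlonglongrightarrow> 0"
proof (rule tendsto_sandwich[OF _ _ tendsto_const])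
  show "(\<lambda>n. (h (u n) / s n / \<kappa>) powr (1 / \<beta>)) \<longlonglongrightarrow> 0"
  proof (rule tendsto_zero_powrI[OF _ tendsto_const])
    show "(\<lambda>n. h (u n) / s n / \<kappa>) \<longlonglongrightarrow> 0"
      using tendsto_divide[OF lim tendsto_const[of \<kappa>]] assms by simp
    have "0 \<le> h (u n)" for n
      using order_trans[OF _ ge[of "u n"], of 0] assms by simp
    then show "\<forall>\<^sub>F n in sequentially. 0 \<le> h (u n) / s n / \<kappa>" using assms by simp
  qed (use assms in simp)
  have "real (u n) / s n powr (1 / \<beta>) \<le> (h (u n) / s n / \<kappa>) powr (1 / \<beta>)" for n
  proof -
    have "real (u n) = (real (u n) powr \<beta>) powr (1 / \<beta>)"
      using assms by (simp add: powr_powr)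
    then have "real (u n) / s n powr (1 / \<beta>) = (real (u n) powr \<beta> / s n) powr (1 / \<beta>)"
      using assms by (simp add: powr_divide)
    also have "\<dots> \<le> (h (u n) / s n / \<kappa>) powr (1 / \<beta>)"
    proof (rule powr_mono2)
      have "real (u n) powr \<beta> \<le> h (u n) / \<kappa>" using ge[of "u n"] assms by (simp add: field_simps)
      then show "real (u n) powr \<beta> / s n \<le> h (u n) / s n / \<kappa>"
        using assms(4)[of n] by (metis divide_divide_eq_left divide_right_mono mult.commute)
    qed (use assms in auto)
    finally show ?thesis .
  qed
  then show "\<forall>\<^sub>F n in sequentially. real (u n) / s n powr (1 / \<beta>) \<le> (h (u n) / s n / \<kappa>) powr (1 / \<beta>)"
    by simp
qed (simp add: assms)

lemma lower_scale_transfer: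
  fixes u :: "nat \<Rightarrow> nat"
  assumes le: "\<And>x. h x \<le> C * real x powr \<gamma>" and "C > 0" "\<gamma> > 0" "\<delta> > 0"
    and freq: "\<exists>\<^sub>F n in sequentially. h (u n) > \<delta> * real n"
  shows "\<exists>\<^sub>F n in sequentially. (\<delta> / C) powr (1 / \<gamma>) * real n powr (1 / \<gamma>) \<le> real (u n)"
  using freq
proof (rule frequently_elim1)
  fix n assume "h (u n) > \<delta> * real n"
  with le[of "u n"] have "\<delta> * real n \<le> C * real (u n) powr \<gamma>" by linarith
  then have "\<delta> / C * real n \<le> real (u n) powr \<gamma>" using assms by (simp add: field_simps)
  then have "(\<delta> / C * real n) powr (1 / \<gamma>) \<le> (real (u n) powr \<gamma>) powr (1 / \<gamma>)"
    using assms by (intro powr_mono2) auto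
  moreover have "(real (u n) powr \<gamma>) powr (1 / \<gamma>) = real (u n)"
    using assms by (simp add: powr_powr)
  ultimately show "(\<delta> / C) powr (1 / \<gamma>) * real n powr (1 / \<gamma>) \<le> real (u n)"
    unfolding powr_mult by simp
qed

lemma le_limsup_if_frequently:
  fixes u :: "nat \<Rightarrow> ereal"
  assumes "\<exists>\<^sub>F n in sequentially. a \<le> u n"
  shows "a \<le> limsup u"
proof (rule ccontr)
  assume "\<not> a \<le> limsup u"
  then have "\<forall>\<^sub>F n in sequentially. u n < a" by (intro Limsup_lessD) simp
  with assms show False by (simp add: frequently_def not_le)
qed

lemma limsup_pos_if_frequently:
  assumes "\<kappa> > 0" "\<exists>\<^sub>F n in sequentially. \<kappa> * real n powr p \<le> real (u n)"
  shows "limsup (\<lambda>n. ereal (real (u n) / real n powr p)) > 0"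
proof -
  have "\<exists>\<^sub>F n in sequentially. ereal \<kappa> \<le> ereal (real (u n) / real n powr p)"
    using frequently_eventually_frequently[OF assms(2) eventually_gt_at_top[of 0]]
    by (rule frequently_elim1) (auto simp: field_simps)
  then have "ereal \<kappa> \<le> limsup (\<lambda>n. ereal (real (u n) / real n powr p))"
    by (rule le_limsup_if_frequently)
  moreover have "0 < ereal \<kappa>" using assms(1) by simp
  ultimately show ?thesis by (rule less_le_trans[rotated])
qed

lemma limsup_infinite_if_frequently:
  assumes "\<kappa> > 0" "q < p" and freq: "\<exists>\<^sub>F n in sequentially. \<kappa> * real n powr p \<le> real (u n)"
  shows "limsup (\<lambda>n. ereal (real (u n) / real n powr q)) = \<infinity>"
proof (rule ereal_top)
  fix a :: real
  have "\<forall>\<^sub>F n in sequentially. (\<bar>a\<bar> / \<kappa>) powr (1 / (p - q)) \<le> real n"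
    using filterlim_real_sequentially by (simp add: filterlim_at_top)
  then have "\<forall>\<^sub>F n in sequentially. a \<le> \<kappa> * real n powr (p - q) \<and> n > 0"
    using eventually_gt_at_top[of 0]
  proof eventually_elim
    case (elim n)
    have "\<bar>a\<bar> / \<kappa> = ((\<bar>a\<bar> / \<kappa>) powr (1 / (p - q))) powr (p - q)"
      using assms by (simp add: powr_powr)
    also have "\<dots> \<le> real n powr (p - q)"
      using elim assms by (intro powr_mono2) auto
    finally have "\<bar>a\<bar> \<le> \<kappa> * real n powr (p - q)"
      using assms by (simp add: field_simps)
    with elim show ?case by simp
  qed
  from frequently_eventually_frequently[OF freq this]
  have "\<exists>\<^sub>F n in sequentially. ereal a \<le> ereal (real (u n) / real n powr q)"
  proof (rule frequently_elim1)
    fix n assume n: "\<kappa> * real n powr p \<le> real (u n) \<and> a \<le> \<kappa> * real n powr (p - q) \<and> n > 0"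
    then have "\<kappa> * real n powr (p - q) \<le> real (u n) / real n powr q"
      by (simp add: powr_diff divide_right_mono)
    with n show "ereal a \<le> ereal (real (u n) / real n powr q)" by simp
  qed
  then show "ereal a \<le> limsup (\<lambda>n. ereal (real (u n) / real n powr q))"
    by (rule le_limsup_if_frequently)
qed

section \<open>The growth of the walk\<close>

theorem theorem2p5:
  fixes M :: "'a measure" and X :: "nat \<Rightarrow> 'a \<Rightarrow> nat" and \<alpha> :: real
  assumes "\<alpha> \<le> 1"
    and "lerrw M X (\<lambda>x. if x = 0 then 1 else real x powr \<alpha>) 0"
  shows
    "(\<alpha> < -1 \<longrightarrow> (\<forall>\<epsilon>>0. AE \<omega> in M.
        limsup (\<lambda>n. ereal (real (X n \<omega>) / real n powr (1 / (1 - \<alpha>)))) > 0 \<and>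
        (\<lambda>n. real (X n \<omega>) / (real n * ln (real n) powr (1 + \<epsilon>)) powr (1 / (1 - \<alpha>)))
          \<longlonglongrightarrow> 0)) \<and>
     (\<alpha> = -1 \<longrightarrow> (\<forall>\<epsilon>>0. AE \<omega> in M.
        limsup (\<lambda>n. ereal (real (X n \<omega>) / real n powr ((1 - \<epsilon>) / 2))) = \<infinity> \<and>
        (\<lambda>n. real (X n \<omega>) / (real n * ln (real n) powr (1 + \<epsilon>)) powr (1 / 2))
          \<longlonglongrightarrow> 0)) \<and>
     (-1 < \<alpha> \<longrightarrow> (\<forall>\<epsilon>>0. AE \<omega> in M.
        limsup (\<lambda>n. ereal (real (X n \<omega>) / real n powr (1 / 2))) > 0 \<and>
        (\<lambda>n. real (X n \<omega>) / (real n * ln (real n) powr (1 + \<epsilon>)) powr (1 / 2))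
          \<longlonglongrightarrow> 0))"
proof -
  have "power_weight \<alpha> = (\<lambda>x. if x = 0 then 1 else real x powr \<alpha>)"
    by (simp add: fun_eq_iff power_weight_def)
  then interpret unreinforced M X "power_weight \<alpha>"
    using assms(2) by (simp add: unreinforced_def)
  define R :: real where "R = 2 powr \<bar>\<alpha>\<bar>"
  define K where "K = (2 + R) * R"
  have R: "R \<ge> 1" by (simp add: R_def ge_one_powr_ge_zero)
  have K: "K \<ge> 1"
    using mult_mono[of 1 "2 + R" 1 R] R by (simp add: K_def)
  have growth: "g (Suc x) \<le> K * (g x + 1)" for x
    unfolding K_def using power_weight_ratio[of \<alpha>]
    by (intro hit_time_growth power_weight_pos R) (simp_all add: R_def)

  have upper: "AE \<omega> in M. (\<lambda>n. real (X n \<omega>) / (real n * ln (real n) powr (1 + \<epsilon>)) powr (1 / \<beta>)) \<longlonglongrightarrow> 0"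
    if "\<epsilon> > 0" "\<kappa> > 0" "\<beta> > 0" "\<And>x. \<kappa> * real x powr \<beta> \<le> g x" for \<epsilon> \<kappa> \<beta>
    using AE_hit_time_upper[OF that(1)]
    by eventually_elim (rule upper_scale_transfer[OF that(4,2,3)], simp_all)

  have upper_square: "AE \<omega> in M. (\<lambda>n. real (X n \<omega>) / (real n * ln (real n) powr (1 + \<epsilon>)) powr (1 / 2)) \<longlonglongrightarrow> 0"
    if "\<epsilon> > 0" for \<epsilon>
    by (rule upper[OF that _ _ hit_time_ge_square[OF assms(1)]]) simp_all

  have lower: "\<exists>\<kappa>>0. AE \<omega> in M. \<exists>\<^sub>F n in sequentially.
      \<kappa> * real n powr (1 / (1 + \<theta> - \<alpha>)) \<le> real (X n \<omega>)"
    if mass: "\<And>x. x \<ge> 1 \<Longrightarrow> mass (power_weight \<alpha>) x \<le> C * real x powr \<theta>"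
      and "C \<ge> 0" "\<alpha> \<le> \<theta>" for C \<theta>
  proof (intro exI conjI)
    show "(1 / (2 * K) / (1 + C)) powr (1 / (1 + \<theta> - \<alpha>)) > 0" using K that by simp
    show "AE \<omega> in M. \<exists>\<^sub>F n in sequentially.
        (1 / (2 * K) / (1 + C)) powr (1 / (1 + \<theta> - \<alpha>)) * real n powr (1 / (1 + \<theta> - \<alpha>)) \<le> real (X n \<omega>)"
      using AE_hit_time_lower[OF growth K]
      by eventually_elim (rule lower_scale_transfer[OF hit_time_le[OF that]], use that K in simp_all)
  qed

  show ?thesis
  proof (intro conjI impI allI)
    fix \<epsilon> :: real assume "\<alpha> < -1" "\<epsilon> > 0"
    obtain C where C: "C \<ge> 0" "\<And>x. mass (power_weight \<alpha>) x \<le> C"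
      using mass_power_weight_bounded[OF \<open>\<alpha> < -1\<close>] by blast
    obtain \<kappa> where \<kappa>: "\<kappa> > 0" "AE \<omega> in M. \<exists>\<^sub>F n in sequentially.
        \<kappa> * real n powr (1 / (1 - \<alpha>)) \<le> real (X n \<omega>)"
      using lower[of C 0] C \<open>\<alpha> < -1\<close> by auto
    have "AE \<omega> in M. (\<lambda>n. real (X n \<omega>) / (real n * ln (real n) powr (1 + \<epsilon>)) powr (1 / (1 - \<alpha>))) \<longlonglongrightarrow> 0"
      using \<open>\<alpha> < -1\<close> by (intro upper[OF \<open>\<epsilon> > 0\<close> _ _ hit_time_ge_powr]) simp_all
    with \<kappa>(2) show "AE \<omega> in M.
        limsup (\<lambda>n. ereal (real (X n \<omega>) / real n powr (1 / (1 - \<alpha>)))) > 0 \<and>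
        (\<lambda>n. real (X n \<omega>) / (real n * ln (real n) powr (1 + \<epsilon>)) powr (1 / (1 - \<alpha>))) \<longlonglongrightarrow> 0"
      by eventually_elim (simp add: limsup_pos_if_frequently[OF \<kappa>(1)])
  next
    fix \<epsilon> :: real assume \<alpha>: "\<alpha> = -1" and "\<epsilon> > 0"
    obtain \<kappa> where \<kappa>: "\<kappa> > 0" "AE \<omega> in M. \<exists>\<^sub>F n in sequentially.
        \<kappa> * real n powr (1 / (1 + \<epsilon> - \<alpha>)) \<le> real (X n \<omega>)"
      using lower[of "2 * (2 + 1 / \<epsilon>)" \<epsilon>] mass_power_weight_le[of \<epsilon> \<alpha>] \<alpha> \<open>\<epsilon> > 0\<close> by auto
    \<comment> \<open>The exponent \<open>1 / (2 + \<epsilon>)\<close> obtained from \<open>\<theta> = \<epsilon>\<close> exceeds the required one strictly, which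
      turns a positive limit superior into an infinite one.\<close>
    have exponent: "(1 - \<epsilon>) / 2 < 1 / (1 + \<epsilon> - \<alpha>)"
    proof -
      have "(1 - \<epsilon>) * (2 + \<epsilon>) < 2"
        using mult_pos_pos[OF \<open>\<epsilon> > 0\<close> \<open>\<epsilon> > 0\<close>] \<open>\<epsilon> > 0\<close> by (simp add: algebra_simps add_pos_pos)
      then show ?thesis using \<alpha> \<open>\<epsilon> > 0\<close> by (simp add: field_simps)
    qed
    from \<kappa>(2) upper_square[OF \<open>\<epsilon> > 0\<close>] show "AE \<omega> in M.
        limsup (\<lambda>n. ereal (real (X n \<omega>) / real n powr ((1 - \<epsilon>) / 2))) = \<infinity> \<and>
        (\<lambda>n. real (X n \<omega>) / (real n * ln (real n) powr (1 + \<epsilon>)) powr (1 / 2)) \<longlonglongrightarrow> 0"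
      by eventually_elim (simp add: limsup_infinite_if_frequently[OF \<kappa>(1) exponent])
  next
    fix \<epsilon> :: real assume \<alpha>: "-1 < \<alpha>" and "\<epsilon> > 0"
    obtain \<kappa> where \<kappa>: "\<kappa> > 0" "AE \<omega> in M. \<exists>\<^sub>F n in sequentially.
        \<kappa> * real n powr (1 / 2) \<le> real (X n \<omega>)"
      using lower[of "2 * (2 + 1 / (1 + \<alpha>))" "1 + \<alpha>"] mass_power_weight_le[of "1 + \<alpha>" \<alpha>] \<alpha> by auto
    from \<kappa>(2) upper_square[OF \<open>\<epsilon> > 0\<close>] show "AE \<omega> in M.
        limsup (\<lambda>n. ereal (real (X n \<omega>) / real n powr (1 / 2))) > 0 \<and>
        (\<lambda>n. real (X n \<omega>) / (real n * ln (real n) powr (1 + \<epsilon>)) powr (1 / 2)) \<longlonglongrightarrow> 0"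
      by eventually_elim (simp add: limsup_pos_if_frequently[OF \<kappa>(1)])
  qed
qed

end
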